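(* Let $\mathsf{AP}$ be any finite set of atomic propositions. Then $\mathsf{LTL}_{\mathsf{X},\land,\lor,\top,\bot}[\mathsf{AP}]$ admits finite characterizations over $\mathcal{W}^{\leq\omega}$ and over $\mathcal{W}^{=\omega}$. Moreover, every $\mathsf{LTL}_{\mathsf{X},\land,\lor,\top,\bot}[\mathsf{AP}]$-formula $\varphi$ is uniquely characterized with respect to $\mathsf{LTL}_{\mathsf{X},\land,\lor,\top,\bot}[\mathsf{AP}]$ (over $\mathcal{W}^{\mathsf{all}}$) by a finite set of labeled examples whose words are finitely presentable and of ordinal length at most $\omega$.
   Context: Words: for a countable ordinal $\alpha$, an $\alpha$-word is a function $w:\alpha\to\mathcal{P}(\mathsf{AP})$; $|w|=\alpha$; for $\beta<|w|$, $w[\beta..]$ is the suffix $w'$ with $w'[\gamma]=w[\beta+\gamma]$ (of length the unique $\gamma_0$ with $\beta+\gamma_0=|w|$). $\mathcal{W}^{\mathsf{all}}$: all words of countable ordinal length; $\mathcal{W}^{\leq\omega}$: words of length $\leq\omega$; $\mathcal{W}^{=\omega}$: words of length exactly $\omega$. Finitely presentable words: word-expressions are generated by: each $\sigma\subseteq\mathsf{AP}$ (denoting the one-letter word $\sigma$); $A\cdot B$ (concatenation: if $A$ denotes an $\alpha$-word $w_A$ and $B$ a $\beta$-word $w_B$, it denotes the $(\alpha+\beta)$-word equal to $w_A[\gamma]$ for $\gamma<\alpha$ and $w_B[\gamma-\alpha]$ otherwise); $(A)^\omega$ (denoting the $(\alpha\cdot\omega)$-word $\gamma\mapsto w_A[\gamma\bmod\alpha]$).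 A word is finitely presentable if some word-expression denotes it. Semantics of the relevant connectives: $w\models\top$ always, $w\not\models\bot$; $w\models p$ iff $p\in w[0]$; $\land,\lor$ as usual; $w\models\mathsf{X}\varphi$ iff $|w|>1$ and $w[1..]\models\varphi$. $\mathsf{LTL}_{\mathsf{X},\land,\lor,\top,\bot}[\mathsf{AP}]$ is the set of formulas built from atomic propositions of $\mathsf{AP}$ using $\mathsf{X},\land,\lor,\top,\bot$. $[\![\varphi]\!]$ is the set of words in $\mathcal{W}^{\mathsf{all}}$ satisfying $\varphi$. A labeled example is $(w,\ell)$ with $\ell\in\{+,-\}$; $\varphi$ fits it if ($w\models\varphi$ and $\ell=+$) or ($w\not\models\varphi$ and $\ell=-$). A finite set $E$ of labeled examples uniquely characterizes $\varphi$ with respect to a fragment $\mathcal{L}$ (over $\mathcal{W}^{\mathsf{all}}$) if $\varphi$ fits all of $E$ and every $\psi\in\mathcal{L}$ fitting all of $E$ has $[\![\psi]\!]=[\![\varphi]\!]$. A fragment $\mathcal{L}$ admits finite characterizations over a class $\mathcal{W}$ of words if for each $\varphi\in\mathcal{L}$ there is a finite set $E$ of labeled examples with words in $\mathcal{W}$ such that $\varphi$ fits $E$ and every $\psi\in\mathcal{L}$ fitting $E$ satisfies $[\![\psi]\!]\cap\mathcal{W}=[\![\varphi]\!]\cap\mathcal{W}$. *)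

theory Defs
  imports "HOL-Library.Countable_Set"
begin

section \<open>Countable ordinals\<close>

text \<open>The order types of well-orders on subsets of \<^typ>\<open>nat\<close>, that is, the countable ordinals
  (zero and the finite ones included).\<close>

quotient_type cord = "nat rel" / partial: "\<lambda>r s. (r, s) \<in> ordIso"
proof (rule part_equivpI)
  have "Well_order ({} :: nat rel)"
    by simp
  then show "\<exists>r :: nat rel. (r, r) \<in> ordIso"
    using ordIso_reflexive by blast
  show "symp (\<lambda>r s :: nat rel. (r, s) \<in> ordIso)"
    by (simp add: sympI ordIso_symmetric)
  show "transp (\<lambda>r s :: nat rel. (r, s) \<in> ordIso)"
    by (meson transpI ordIso_transitive)
qed

instantiation cord :: wellorder
begin

lift_definition less_eq_cord :: "cord \<Rightarrow> cord \<Rightarrow> bool" is "\<lambda>r s. (r, s) \<in> ordLeq"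
  by (meson ordIso_symmetric ordIso_ordLeq_trans ordLeq_ordIso_trans)

lift_definition less_cord :: "cord \<Rightarrow> cord \<Rightarrow> bool" is "\<lambda>r s. (r, s) \<in> ordLess"
  by (meson ordIso_symmetric ordIso_ordLess_trans ordLess_ordIso_trans)

instance
proof
  fix x y z :: cord
  show "x < y \<longleftrightarrow> x \<le> y \<and> \<not> y \<le> x"
    by transfer (meson not_ordLess_ordLeq not_ordLeq_iff_ordLess ordIso_iff_ordLeq
        ordLeq_Well_order_simp ordLess_imp_ordLeq)
  show "x \<le> x"
    by transfer (simp add: ordIso_iff_ordLeq)
  show "x \<le> y \<Longrightarrow> y \<le> z \<Longrightarrow> x \<le> z"
    by transfer (rule ordLeq_transitive)
  show "x \<le> y \<Longrightarrow> y \<le> x \<Longrightarrow> x = y"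
    by transfer (simp add: ordIso_iff_ordLeq)
  show "x \<le> y \<or> y \<le> x"
    by transfer (meson ordIso_iff_ordLeq ordLeq_Well_order_simp ordLeq_total)
next
  fix P :: "cord \<Rightarrow> bool" and a :: cord
  assume step: "\<And>x. (\<And>y. y < x \<Longrightarrow> P y) \<Longrightarrow> P x"
  have "wfp ((<) :: cord \<Rightarrow> cord \<Rightarrow> bool)"
  proof -
    have "wf (inv_image (ordLess :: (nat rel \<times> nat rel) set) rep_cord)"
      using wf_ordLess by (rule wf_inv_image)
    moreover have "(rep_cord x, rep_cord y) \<in> ordLess" if "x < y" for x y
      using that by (simp add: less_cord_def)
    ultimately show ?thesis
      unfolding wfp_def by (auto elim!: wf_subset simp: inv_image_def)
  qed
  then show "P a"
    using step by (rule wfp_induct_rule)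
qed

end

lemma countable_lessThan_cord: "countable {..<a :: cord}"
proof -
  have "\<exists>n. x = abs_cord (Restr (rep_cord a) (underS (rep_cord a) n))" if "x < a" for x
  proof -
    have *: "(rep_cord x, rep_cord a) \<in> ordLess"
      using that by (simp add: less_cord_def)
    then have "Well_order (rep_cord x)" "Well_order (rep_cord a)"
      by (auto simp: ordLess_def)
    from ordLess_iff_ordIso_Restr[OF this(2,1)] *
    obtain n where n: "(rep_cord x, Restr (rep_cord a) (underS (rep_cord a) n)) \<in> ordIso"
      by auto
    from Quotient3_rel_abs[OF Quotient3_cord this] Quotient3_abs_rep[OF Quotient3_cord]
    show ?thesis
      by metis
  qed
  then have "{..<a} \<subseteq> range (\<lambda>n. abs_cord (Restr (rep_cord a) (underS (rep_cord a) n)))"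
    by auto
  then show ?thesis
    by (rule countable_subset) simp
qed

lemma strict_mono_cord_ge:
  fixes g :: "cord \<Rightarrow> cord"
  assumes "strict_mono g"
  shows "x \<le> g x"
proof (induction x rule: less_induct)
  case (less x)
  show ?case
  proof (rule ccontr)
    assume "\<not> x \<le> g x"
    then have "g x < x" by simp
    then show False
      using less[of "g x"] strict_monoD[OF assms, of "g x" x] by simp
  qed
qed

lemma uncountable_UNIV_cord: "\<not> countable (UNIV :: cord set)"
proof
  assume "countable (UNIV :: cord set)"
  then obtain f :: "cord \<Rightarrow> nat" where f: "inj f"
    by (auto simp: countable_def)
  define R where "R = {(x :: cord, y). x \<le> y}"
  have FR: "Field R = UNIV"
    by (auto simp: R_def Field_def)
  have RId: "R - Id = {(x, y). x < y}"
    by (auto simp: R_def)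
  have woR: "Well_order R"
    unfolding well_order_on_def linear_order_on_def partial_order_on_def preorder_on_def FR RId
    by (auto simp: R_def refl_on_def trans_def antisym_def total_on_def wf_def
        intro: less_induct)
  define r where "r = dir_image R f"
  have wor: "Well_order r"
    unfolding r_def using woR f FR by (intro Well_order_dir_image) simp_all
  have Fr: "Field r = range f"
    by (simp add: r_def dir_image_Field FR)
  have r_iff: "(f x, f y) \<in> r \<longleftrightarrow> x \<le> y" for x y
    using f by (auto simp: r_def dir_image_def R_def inj_eq)
  define D where "D x = Restr r (underS r (f x))" for x
  have D_less_r: "(D x, r) \<in> ordLess" for x
    unfolding D_def using wor Fr by (intro underS_Restr_ordLess) auto
  have D_less: "(D x, D y) \<in> ordLess" if "x < y" for x y
  proof -
    have wo: "wo_rel r"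
      using wor by (simp add: wo_rel_def)
    have "underS r (f x) \<subset> underS r (f y)"
    proof
      have "f x \<in> underS r (f y)" "f x \<notin> underS r (f x)"
        using that f by (auto simp: underS_def r_iff inj_eq)
      then show "underS r (f x) \<noteq> underS r (f y)"
        by blast
      show "underS r (f x) \<subseteq> underS r (f y)"
        using that wor Fr by (simp add: r_iff underS_incl_iff well_order_on_def order.strict_implies_order)
    qed
    then show ?thesis
      unfolding D_def using wor wo_rel.underS_ofilter[OF wo]
      by (simp add: ofilter_subset_ordLess)
  qed
  define g where "g x = abs_cord (D x)" for x
  have abs_less: "abs_cord s < abs_cord t" if "(s, t) \<in> ordLess" for s t
  proof -
    have "(s, s) \<in> ordIso" "(t, t) \<in> ordIso"
      using that by (auto simp: ordLess_def intro: ordIso_reflexive)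
    then show ?thesis
      using that by (simp add: less_cord.abs_eq)
  qed
  have "strict_mono g"
    by (simp add: strict_mono_def g_def D_less abs_less)
  then have "abs_cord r \<le> g (abs_cord r)"
    by (rule strict_mono_cord_ge)
  also have "\<dots> < abs_cord r"
    unfolding g_def by (intro abs_less D_less_r)
  finally show False
    by simp
qed

text \<open>By this boundedness the \<open>LEAST\<close>s below are taken over nonempty sets.\<close>

lemma countable_bounded_cord:
  fixes A :: "cord set"
  assumes "countable A"
  shows "\<exists>b. \<forall>a\<in>A. a < b"
proof (rule ccontr)
  assume "\<not> ?thesis"
  then have "\<forall>b. \<exists>a\<in>A. b \<le> a"
    by (meson not_less)
  then have "UNIV = (\<Union>a\<in>A. {..<a} \<union> {a})"
    by (auto simp: le_less)
  also have "countable \<dots>"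
    using assms by (simp add: countable_lessThan_cord)
  finally show False
    using uncountable_UNIV_cord by simp
qed

instantiation cord :: "{zero, one, plus, times}"
begin

definition zero_cord :: cord where
  "(0 :: cord) = (LEAST x. True)"

definition one_cord :: cord where
  "(1 :: cord) = (LEAST x. 0 < x)"

text \<open>\<open>\<alpha> + \<beta>\<close> is the supremum of \<open>\<alpha>\<close> and the successors of the \<open>\<alpha> + \<gamma>\<close> for \<open>\<gamma> < \<beta>\<close>.\<close>

function plus_cord :: "cord \<Rightarrow> cord \<Rightarrow> cord" where
  "(\<alpha> :: cord) + \<beta> = (LEAST x. \<alpha> \<le> x \<and> (\<forall>\<gamma>\<in>{..<\<beta>}. \<alpha> + \<gamma> < x))"
  by pat_completeness auto
termination
proof (relation "inv_image {(x, y). x < y} snd")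
  show "wf (inv_image {(x, y). x < y} (snd :: cord \<times> cord \<Rightarrow> cord))"
    by (intro wf_inv_image wf)
qed simp

declare plus_cord.simps [simp del]

text \<open>\<open>\<alpha> \<cdot> \<beta>\<close> is the supremum of the \<open>\<alpha> \<cdot> \<gamma> + \<alpha>\<close> for \<open>\<gamma> < \<beta>\<close>.\<close>

function times_cord :: "cord \<Rightarrow> cord \<Rightarrow> cord" where
  "(\<alpha> :: cord) * \<beta> = (LEAST x. \<forall>\<gamma>\<in>{..<\<beta>}. \<alpha> * \<gamma> + \<alpha> \<le> x)"
  by pat_completeness auto
termination
proof (relation "inv_image {(x, y). x < y} snd")
  show "wf (inv_image {(x, y). x < y} (snd :: cord \<times> cord \<Rightarrow> cord))"
    by (intro wf_inv_image wf)
qed simp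

declare times_cord.simps [simp del]

instance ..

end

text \<open>The least nonzero limit ordinal.\<close>

definition omega :: cord ("\<omega>") where
  "\<omega> = (LEAST x. 0 < x \<and> (\<forall>y<x. y + 1 < x))"

text \<open>The remainder of \<open>\<gamma>\<close> modulo \<open>\<alpha>\<close>, for \<open>\<alpha> > 0\<close>.\<close>

definition cord_mod :: "cord \<Rightarrow> cord \<Rightarrow> cord" where
  "cord_mod \<gamma> \<alpha> = (THE \<delta>. \<delta> < \<alpha> \<and> (\<exists>\<xi>. \<gamma> = \<alpha> * \<xi> + \<delta>))"


section \<open>Words\<close>

text \<open>An \<open>\<alpha>\<close>-word is a partial map whose domain is the set of ordinals below \<open>\<alpha>\<close>. The case
  \<open>\<alpha> = 0\<close> is allowed.\<close>

type_synonym 'p word = "cord \<rightharpoonup> 'p set"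

definition words :: "'p set \<Rightarrow> 'p word set" where
  "words AP = {w. (\<exists>\<alpha>. dom w = {..<\<alpha>}) \<and> ran w \<subseteq> Pow AP}"

definition wlen :: "'p word \<Rightarrow> cord" where
  "wlen w = (THE \<alpha>. dom w = {..<\<alpha>})"

definition words_le_omega :: "'p set \<Rightarrow> 'p word set" where
  "words_le_omega AP = {w \<in> words AP. wlen w \<le> \<omega>}"

definition words_omega :: "'p set \<Rightarrow> 'p word set" where
  "words_omega AP = {w \<in> words AP. wlen w = \<omega>}"

text \<open>For \<open>\<beta> < wlen w\<close> the domain of the suffix consists of the \<open>\<gamma>\<close> with \<open>\<beta> + \<gamma> < wlen w\<close>, so its
  length is the \<open>\<gamma>\<^sub>0\<close> with \<open>\<beta> + \<gamma>\<^sub>0 = wlen w\<close>.\<close>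

definition suffix :: "'p word \<Rightarrow> cord \<Rightarrow> 'p word" where
  "suffix w \<beta> = (\<lambda>\<gamma>. w (\<beta> + \<gamma>))"


section \<open>Finitely presentable words\<close>

datatype (letters: 'l) word_expr =
  Letter 'l
| Concat "'l word_expr" "'l word_expr"
| Omega "'l word_expr"

definition word_concat :: "'p word \<Rightarrow> 'p word \<Rightarrow> 'p word" where
  "word_concat u v =
     (\<lambda>\<gamma>. if \<gamma> < wlen u then u \<gamma> else v (THE \<delta>. wlen u + \<delta> = \<gamma>))"

definition word_omega :: "'p word \<Rightarrow> 'p word" where
  "word_omega u = (\<lambda>\<gamma>. if \<gamma> < wlen u * \<omega> then u (cord_mod \<gamma> (wlen u)) else None)"

primrec denotation :: "'p set word_expr \<Rightarrow> 'p word" where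
  "denotation (Letter \<sigma>) = [0 \<mapsto> \<sigma>]"
| "denotation (Concat A B) = word_concat (denotation A) (denotation B)"
| "denotation (Omega A) = word_omega (denotation A)"

definition finitely_presentable :: "'p set \<Rightarrow> 'p word \<Rightarrow> bool" where
  "finitely_presentable AP w \<longleftrightarrow> (\<exists>A. letters A \<subseteq> Pow AP \<and> denotation A = w)"


section \<open>Formulas\<close>

datatype (atoms: 'p) ltl =
  Top
| Bot
| Atom 'p
| And "'p ltl" "'p ltl"
| Or "'p ltl" "'p ltl"
| Next "'p ltl"

definition ltl_formulas :: "'p set \<Rightarrow> 'p ltl set" where
  "ltl_formulas AP = {\<phi>. atoms \<phi> \<subseteq> AP}"

text \<open>Atoms are false in the empty word, which has no initial letter.\<close>

primrec sat :: "'p word \<Rightarrow> 'p ltl \<Rightarrow> bool" (infix "\<Turnstile>" 50) where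
  "w \<Turnstile> Top \<longleftrightarrow> True"
| "w \<Turnstile> Bot \<longleftrightarrow> False"
| "w \<Turnstile> Atom p \<longleftrightarrow> (\<exists>\<sigma>. w 0 = Some \<sigma> \<and> p \<in> \<sigma>)"
| "w \<Turnstile> And \<phi> \<psi> \<longleftrightarrow> w \<Turnstile> \<phi> \<and> w \<Turnstile> \<psi>"
| "w \<Turnstile> Or \<phi> \<psi> \<longleftrightarrow> w \<Turnstile> \<phi> \<or> w \<Turnstile> \<psi>"
| "w \<Turnstile> Next \<phi> \<longleftrightarrow> 1 < wlen w \<and> suffix w 1 \<Turnstile> \<phi>"

definition sem :: "'p set \<Rightarrow> 'p ltl \<Rightarrow> 'p word set" where
  "sem AP \<phi> = {w \<in> words AP. w \<Turnstile> \<phi>}"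


section \<open>Labeled examples and characterizations\<close>

datatype label = Pos | Neg

definition fits :: "'p ltl \<Rightarrow> ('p word \<times> label) set \<Rightarrow> bool" where
  "fits \<phi> E \<longleftrightarrow> (\<forall>(w, l)\<in>E. w \<Turnstile> \<phi> \<and> l = Pos \<or> \<not> w \<Turnstile> \<phi> \<and> l = Neg)"

definition uniquely_characterizes ::
  "'p set \<Rightarrow> ('p word \<times> label) set \<Rightarrow> 'p ltl \<Rightarrow> 'p ltl set \<Rightarrow> bool" where
  "uniquely_characterizes AP E \<phi> L \<longleftrightarrow>
     finite E \<and> fst ` E \<subseteq> words AP \<and> fits \<phi> E \<and>
     (\<forall>\<psi>\<in>L. fits \<psi> E \<longrightarrow> sem AP \<psi> = sem AP \<phi>)"

definition admits_finite_characterizations ::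
  "'p set \<Rightarrow> 'p ltl set \<Rightarrow> 'p word set \<Rightarrow> bool" where
  "admits_finite_characterizations AP L W \<longleftrightarrow>
     (\<forall>\<phi>\<in>L. \<exists>E. finite E \<and> fst ` E \<subseteq> W \<and> fits \<phi> E \<and>
        (\<forall>\<psi>\<in>L. fits \<psi> E \<longrightarrow> sem AP \<psi> \<inter> W = sem AP \<phi> \<inter> W))"

end

theory Submission
  imports Defs
begin

text \<open>Formulas of next-depth \<open>d\<close> only see the letters at the positions \<open>\<le> d\<close>, and they are monotone:
  enlarging letters or appending letters preserves truth. So every word \<open>w\<close> is squeezed, among the
  words with the same first \<open>d + 1\<close> letters, between a least one (the prefix itself, or
  the prefix padded with \<open>{}\<close>) and a greatest one (the prefix padded with \<open>AP\<close>, or \<open>w\<close> if \<open>w\<close> is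
  shorter than that). There are finitely many such bounds. Labelling the lower bounds of the models
  of \<open>\<phi>\<close> positively and the upper bounds of its non-models negatively forces every fitting \<open>\<psi>\<close>, of
  whatever depth, to agree with \<open>\<phi>\<close>.\<close>

section \<open>Finite ordinals and \<open>\<omega>\<close>\<close>

lemma cord_zero_le [simp]: "(0::cord) \<le> a"
  unfolding zero_cord_def by (rule Least_le) simp

lemma cord_not_less_zero [simp]: "\<not> a < (0::cord)"
  by (simp add: not_less)

text \<open>The \<open>LEAST\<close> in the recursion for \<open>+\<close> is attained:
  \<open>a\<close> and the \<open>a + c\<close> for \<open>c < b\<close> form a countable set, which
  is bounded. Together with minimality, as in \<open>cord_plus_leI\<close>, this describes addition
  completely.\<close>

lemma plus_cord_props:
  fixes a b :: cord
  shows "a \<le> a + b \<and> (\<forall>c<b. a + c < a + b)"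
proof -
  have "countable (insert a ((\<lambda>c. a + c) ` {..<b}))"
    by (simp add: countable_lessThan_cord)
  from countable_bounded_cord[OF this] obtain x where "\<forall>y\<in>insert a ((\<lambda>c. a + c) ` {..<b}). y < x"
    by blast
  then have "a \<le> x \<and> (\<forall>c\<in>{..<b}. a + c < x)"
    by auto
  from LeastI[of "\<lambda>x. a \<le> x \<and> (\<forall>c\<in>{..<b}. a + c < x)", OF this] show ?thesis
    unfolding plus_cord.simps[of a b, symmetric] by auto
qed

lemma cord_le_plus [simp]: "(a::cord) \<le> a + b"
  using plus_cord_props by blast

lemma cord_plus_strict_mono: "c < b \<Longrightarrow> (a::cord) + c < a + b"
  using plus_cord_props by blast

lemma cord_plus_less_iff [simp]: "(a::cord) + c < a + b \<longleftrightarrow> c < b"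
  by (metis cord_plus_strict_mono less_irrefl linorder_less_linear order.strict_trans)

lemma cord_plus_le_iff [simp]: "(a::cord) + c \<le> a + b \<longleftrightarrow> c \<le> b"
  by (meson cord_plus_less_iff not_le)

lemma cord_plus_left_cancel [simp]: "(a::cord) + c = a + b \<longleftrightarrow> c = b"
  by (metis cord_plus_strict_mono less_irrefl linorder_less_linear)

lemma cord_plus_leI: "(a::cord) \<le> x \<Longrightarrow> (\<And>c. c < b \<Longrightarrow> a + c < x) \<Longrightarrow> a + b \<le> x"
  unfolding plus_cord.simps[of a b] by (rule Least_le) auto

lemma cord_plus_zero [simp]: "(a::cord) + 0 = a"
  by (intro antisym cord_plus_leI) auto

lemma cord_le_plus_left: "(b::cord) \<le> a + b"
  by (rule strict_mono_cord_ge[of "\<lambda>b. a + b"]) (simp add: strict_mono_def)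

text \<open>Left subtraction. The least \<open>d\<close> with \<open>c \<le> a + d\<close> works:
  smaller summands stay strictly below \<open>c\<close>, so the supremum \<open>a + d\<close> cannot
  exceed \<open>c\<close>.\<close>

lemma cord_le_imp_plus:
  assumes "(a::cord) \<le> c"
  shows "\<exists>d. c = a + d"
proof -
  define d where "d = (LEAST d. c \<le> a + d)"
  have "c \<le> a + d"
    unfolding d_def by (rule LeastI[of _ c]) (rule cord_le_plus_left)
  moreover have "a + d \<le> c"
    using assms by (intro cord_plus_leI) (auto simp: d_def not_le dest: not_less_Least)
  ultimately show ?thesis
    by (blast intro: antisym)
qed

lemma cord_zero_less_one [simp]: "(0::cord) < 1"
proof -
  obtain x :: cord where "0 < x"
    using countable_bounded_cord[of "{0}"] by auto
  then show ?thesis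
    unfolding one_cord_def by (rule LeastI)
qed

lemma cord_less_one_iff [simp]: "(a::cord) < 1 \<longleftrightarrow> a = 0"
  by (metis cord_zero_le cord_zero_less_one le_less not_less_Least one_cord_def)

lemma cord_less_plus_one_iff [simp]: "(a::cord) < b + 1 \<longleftrightarrow> a \<le> b"
proof
  assume "a < b + 1"
  show "a \<le> b"
  proof (rule ccontr)
    assume "\<not> a \<le> b"
    then have "b + 1 \<le> a"
      by (intro cord_plus_leI) auto
    with \<open>a < b + 1\<close> show False by simp
  qed
next
  assume "a \<le> b"
  also have "b < b + 1"
    using cord_plus_strict_mono[of 0 1 b] by simp
  finally show "a < b + 1" .
qed

lemma cord_plus_one_le_iff: "(a::cord) + 1 \<le> b \<longleftrightarrow> a < b"
  by (meson cord_less_plus_one_iff not_le)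

lemma cord_plus_plus_one: "(a::cord) + (b + 1) = (a + b) + 1"
proof (rule antisym)
  show "a + (b + 1) \<le> (a + b) + 1"
  proof (rule cord_plus_leI)
    show "a \<le> a + b + 1"
      by (meson cord_le_plus order_trans)
    show "a + c < a + b + 1" if "c < b + 1" for c
      using that by simp
  qed
  show "(a + b) + 1 \<le> a + (b + 1)"
    by (simp add: cord_plus_one_le_iff)
qed

section \<open>Finite ordinals and their supremum\<close>

primrec fin_cord :: "nat \<Rightarrow> cord" where
  "fin_cord 0 = 0"
| "fin_cord (Suc n) = fin_cord n + 1"

text \<open>Bridges two shifts: \<open>suffix w 1\<close> adds 1 on the left of a position, whereas
  \<open>fin_cord\<close> adds it on the right. They agree at finite positions only.\<close>

lemma one_plus_fin_cord: "1 + fin_cord n = fin_cord (Suc n)"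
proof (induction n)
  case 0
  show ?case
    by (simp add: order_eq_iff cord_le_plus_left cord_plus_one_le_iff)
next
  case (Suc n)
  then show ?case
    by (simp add: cord_plus_plus_one)
qed

lemma fin_cord_1 [simp]: "fin_cord (Suc 0) = 1"
  using one_plus_fin_cord[of 0] by simp

lemma fin_cord_strict_mono: "strict_mono fin_cord"
  by (simp add: strict_mono_Suc_iff)

lemmas fin_cord_less_iff [simp] = strict_mono_less[OF fin_cord_strict_mono]
lemmas fin_cord_le_iff [simp] = strict_mono_less_eq[OF fin_cord_strict_mono]
lemmas fin_cord_eq_iff [simp] = strict_mono_eq[OF fin_cord_strict_mono]

lemma le_fin_cordD: "a \<le> fin_cord n \<Longrightarrow> \<exists>m. a = fin_cord m"
proof (induction n)
  case 0
  then show ?case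
    by (intro exI[of _ 0]) (simp add: order_eq_iff)
next
  case (Suc n)
  then show ?case
    by (metis cord_less_plus_one_iff fin_cord.simps(2) le_less)
qed

text \<open>The supremum \<open>s\<close> of the finite ordinals is a limit, because anything below
  \<open>s\<close> is at most some \<open>fin_cord n\<close> by minimality; conversely, a nonzero
  limit exceeds every finite ordinal by induction.\<close>

lemma omega_eq_Least: "\<omega> = (LEAST x. \<forall>n. fin_cord n < x)"
proof -
  define s where "s = (LEAST x. \<forall>n. fin_cord n < x)"
  obtain x where "\<forall>n. fin_cord n < x"
    using countable_bounded_cord[of "range fin_cord"] by auto
  then have s: "\<forall>n. fin_cord n < s"
    unfolding s_def by (rule LeastI)
  show ?thesis
    unfolding omega_def s_def[symmetric]
  proof (rule Least_equality)
    have "0 < s"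
      using s[rule_format, of 0] by simp
    moreover have "y + 1 < s" if "y < s" for y
    proof -
      have "\<not> (\<forall>n. fin_cord n < y)"
        using that unfolding s_def by (rule not_less_Least)
      then obtain n where "y \<le> fin_cord n"
        by (auto simp: not_less)
      then have "y + 1 \<le> fin_cord (Suc n)"
        by (simp add: cord_plus_one_le_iff)
      then show ?thesis
        using s by (blast intro: le_less_trans)
    qed
    ultimately show "0 < s \<and> (\<forall>y<s. y + 1 < s)" by blast
  next
    fix y :: cord
    assume y: "0 < y \<and> (\<forall>z<y. z + 1 < y)"
    have "fin_cord n < y" for n
      using y by (induction n) auto
    then show "s \<le> y"
      unfolding s_def by (intro Least_le) blast
  qed
qed

lemma less_omega_iff: "a < \<omega> \<longleftrightarrow> a \<in> range fin_cord"
proof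
  assume "a < \<omega>"
  then have "\<not> (\<forall>n. fin_cord n < a)"
    unfolding omega_eq_Least by (rule not_less_Least)
  then show "a \<in> range fin_cord"
    by (auto simp: not_less dest: le_fin_cordD)
next
  obtain x where "\<forall>n. fin_cord n < x"
    using countable_bounded_cord[of "range fin_cord"] by auto
  then have "\<forall>n. fin_cord n < \<omega>"
    unfolding omega_eq_Least by (rule LeastI)
  then show "a \<in> range fin_cord \<Longrightarrow> a < \<omega>"
    by auto
qed

text \<open>By induction the recursion turns into the least strict upper bound of the ordinals below
  \<open>a\<close>. With \<open>cord_mod_one\<close> this evaluates the omega-power of a single
  letter, whose length is \<open>1 * \<omega>\<close>.\<close>

lemma cord_one_times [simp]: "(1::cord) * a = a"
proof (induction a rule: less_induct)
  case (less a)
  then have "(\<forall>c\<in>{..<a}. 1 * c + 1 \<le> x) \<longleftrightarrow> (\<forall>c\<in>{..<a}. c < x)" for x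
    by (simp add: cord_plus_one_le_iff)
  then have "1 * a = (LEAST x. \<forall>c\<in>{..<a}. c < x)"
    unfolding times_cord.simps[of 1 a] by presburger
  also have "\<dots> = a"
    by (rule Least_equality) (auto intro: ccontr simp: not_le)
  finally show ?case .
qed

lemma cord_mod_one [simp]: "cord_mod a 1 = 0"
  unfolding cord_mod_def by (rule the_equality) auto


section \<open>Words and their letters at finite positions\<close>

text \<open>Separates the shape of a word from its alphabet; satisfaction is compared below without
  reference to \<open>AP\<close>.\<close>

definition is_word :: "'p word \<Rightarrow> bool" where
  "is_word w \<longleftrightarrow> (\<exists>\<alpha>. dom w = {..<\<alpha>})"

lemma words_is_word: "w \<in> words AP \<Longrightarrow> is_word w"
  by (simp add: words_def is_word_def)

lemma words_ran: "w \<in> words AP \<Longrightarrow> ran w \<subseteq> Pow AP"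
  by (simp add: words_def)

lemma wlen_eq: "dom w = {..<\<alpha>} \<Longrightarrow> wlen w = \<alpha>"
  unfolding wlen_def by (rule the_equality) auto

lemma dom_is_word: "is_word w \<Longrightarrow> dom w = {..<wlen w}"
  by (metis is_word_def wlen_eq)

lemma less_wlen_iff: "is_word w \<Longrightarrow> a < wlen w \<longleftrightarrow> w a \<noteq> None"
  using dom_is_word[of w] by (metis domIff lessThan_iff)

lemma is_word_suffix:
  assumes "is_word w"
  shows "is_word (suffix w a)"
proof (cases "a \<le> wlen w")
  case True
  then obtain d where "wlen w = a + d"
    using cord_le_imp_plus by blast
  then have "suffix w a c \<noteq> None \<longleftrightarrow> c < d" for c
    using less_wlen_iff[OF assms, of "a + c"] by (simp add: suffix_def)
  then have "dom (suffix w a) = {..<d}"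
    by (simp add: dom_def lessThan_def)
  then show ?thesis
    unfolding is_word_def by blast
next
  case False
  have "\<not> a + c < wlen w" for c
    using False cord_le_plus[of a c] by order
  then have "w (a + c) = None" for c
    using less_wlen_iff[OF assms, of "a + c"] by simp
  then have "dom (suffix w a) = {..<0}"
    by (simp add: suffix_def dom_def lessThan_def)
  then show ?thesis
    unfolding is_word_def by blast
qed

text \<open>A missing letter counts as the least element, below even \<open>Some {}\<close>, so that
  appending letters and enlarging letters are increases in one and the same order.\<close>

definition letter_le :: "'p set option \<Rightarrow> 'p set option \<Rightarrow> bool" where
  "letter_le s t \<longleftrightarrow> (\<forall>\<sigma>. s = Some \<sigma> \<longrightarrow> (\<exists>\<tau>. t = Some \<tau> \<and> \<sigma> \<subseteq> \<tau>))"

lemma letter_le_refl [simp]: "letter_le s s"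
  by (simp add: letter_le_def)

lemma letter_le_None [simp]: "letter_le None s"
  by (simp add: letter_le_def)

section \<open>Next-depth and monotonicity of satisfaction\<close>

primrec depth :: "'p ltl \<Rightarrow> nat" where
  "depth Top = 0"
| "depth Bot = 0"
| "depth (Atom p) = 0"
| "depth (And \<phi> \<psi>) = max (depth \<phi>) (depth \<psi>)"
| "depth (Or \<phi> \<psi>) = max (depth \<phi>) (depth \<psi>)"
| "depth (Next \<phi>) = Suc (depth \<phi>)"

text \<open>There is no negation. In the \<open>Next\<close> case a letter of \<open>v\<close> at
  position 1 forces one in \<open>w\<close>, hence \<open>1 < wlen w\<close>, and position
  \<open>i\<close> of the suffixes is position \<open>Suc i\<close> of the words, still within the
  larger depth.\<close>

lemma sat_mono:
  assumes "is_word v" "is_word w"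
    and "\<And>i. i \<le> depth \<phi> \<Longrightarrow> letter_le (v (fin_cord i)) (w (fin_cord i))"
    and "v \<Turnstile> \<phi>"
  shows "w \<Turnstile> \<phi>"
  using assms
proof (induction \<phi> arbitrary: v w)
  case (Atom p)
  from Atom.prems(3)[of 0] have "letter_le (v 0) (w 0)"
    by simp
  with Atom.prems(4) show ?case
    by (auto simp: letter_le_def)
next
  case (And \<phi> \<psi>)
  have "w \<Turnstile> \<phi>"
    by (rule And.IH(1)[of v]) (use And.prems in auto)
  moreover have "w \<Turnstile> \<psi>"
    by (rule And.IH(2)[of v]) (use And.prems in auto)
  ultimately show ?case by simp
next
  case (Or \<phi> \<psi>)
  have "w \<Turnstile> \<phi>" if "v \<Turnstile> \<phi>"
    by (rule Or.IH(1)[of v]) (use Or.prems(1-3) that in auto)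
  moreover have "w \<Turnstile> \<psi>" if "v \<Turnstile> \<psi>"
    by (rule Or.IH(2)[of v]) (use Or.prems(1-3) that in auto)
  ultimately show ?case
    using Or.prems(4) by auto
next
  case (Next \<phi>)
  from Next.prems(3)[of "Suc 0"] have "letter_le (v 1) (w 1)"
    by (simp del: fin_cord.simps)
  moreover have "v 1 \<noteq> None"
    using Next.prems(4) less_wlen_iff[OF Next.prems(1)] by simp
  ultimately have "w 1 \<noteq> None"
    by (auto simp: letter_le_def)
  then have "1 < wlen w"
    by (simp only: less_wlen_iff[OF Next.prems(2)] not_False_eq_True)
  moreover have "letter_le (suffix v 1 (fin_cord i)) (suffix w 1 (fin_cord i))"
    if "i \<le> depth \<phi>" for i
    using Next.prems(3)[of "Suc i"] that by (simp add: suffix_def one_plus_fin_cord del: fin_cord.simps)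
  then have "suffix w 1 \<Turnstile> \<phi>"
    by (intro Next.IH[of "suffix v 1" "suffix w 1"]) (use Next.prems(1,2,4) in \<open>simp_all add: is_word_suffix\<close>)
  ultimately show ?case by simp
qed simp_all

lemma sat_cong:
  assumes "is_word v" "is_word w"
    and "\<And>i. i \<le> depth \<phi> \<Longrightarrow> v (fin_cord i) = w (fin_cord i)"
  shows "v \<Turnstile> \<phi> \<longleftrightarrow> w \<Turnstile> \<phi>"
proof
  show "w \<Turnstile> \<phi>" if "v \<Turnstile> \<phi>"
    using assms(3) that by (intro sat_mono[OF assms(1,2)]) simp_all
  show "v \<Turnstile> \<phi>" if "w \<Turnstile> \<phi>"
    using assms(3) that by (intro sat_mono[OF assms(2,1)]) simp_all
qed

lemma dom_singleton: "dom [0 \<mapsto> \<sigma>] = {..<1::cord}"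
  by auto

lemma wlen_singleton [simp]: "wlen [0 \<mapsto> \<sigma>] = 1"
  by (rule wlen_eq) (rule dom_singleton)

lemma wlen_empty [simp]: "wlen Map.empty = 0"
  by (rule wlen_eq) auto

text \<open>No word-expression denotes the empty word; this is its presentable substitute.\<close>

lemma sat_empty_word: "Map.empty \<Turnstile> \<phi> \<longleftrightarrow> [0 \<mapsto> {}] \<Turnstile> \<phi>"
proof (induction \<phi>)
  case (Next \<phi>)
  have "\<not> 1 < (0::cord)"
    by (rule cord_not_less_zero)
  then show ?case
    unfolding sat.simps wlen_singleton wlen_empty by simp
qed auto


section \<open>Words of length at most \<open>\<omega>\<close>\<close>

text \<open>Lets words of length at most \<omega> be built as sequences over \<open>nat\<close>,
  with \<open>None\<close> marking the positions after the end.\<close>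

definition nat_word :: "(nat \<Rightarrow> 'p set option) \<Rightarrow> 'p word" where
  "nat_word f = (\<lambda>\<gamma>. if \<gamma> \<in> range fin_cord then f (inv fin_cord \<gamma>) else None)"

definition down_closed :: "(nat \<Rightarrow> 'a option) \<Rightarrow> bool" where
  "down_closed f \<longleftrightarrow> (\<forall>i. f i = None \<longrightarrow> f (Suc i) = None)"

lemma nat_word_fin [simp]: "nat_word f (fin_cord i) = f i"
  by (simp add: nat_word_def inv_f_f strict_mono_imp_inj_on[OF fin_cord_strict_mono])

lemma down_closedD:
  assumes "down_closed f" "f i = None" "i \<le> j"
  shows "f j = None"
  using assms(3,2,1) by (induction rule: dec_induct) (auto simp: down_closed_def)

text \<open>The first \<open>None\<close> decides the length: down-closure makes all later entries
  \<open>None\<close>, and every ordinal below \<open>fin_cord k\<close> is itself finite.\<close>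

lemma dom_nat_word:
  assumes "down_closed f"
  shows "dom (nat_word f) =
    (if \<exists>i. f i = None then {..<fin_cord (LEAST i. f i = None)} else {..<\<omega>})"
proof (cases "\<exists>i. f i = None")
  case True
  define k where "k = (LEAST i. f i = None)"
  have k: "f k = None"
    unfolding k_def using True by (rule LeastI_ex)
  have f_None: "f i = None \<longleftrightarrow> k \<le> i" for i
    using down_closedD[OF assms k, of i] Least_le[of "\<lambda>i. f i = None" i, folded k_def] by blast
  have "\<gamma> \<in> dom (nat_word f) \<longleftrightarrow> \<gamma> \<in> fin_cord ` {..<k}" for \<gamma>
  proof (cases "\<gamma> \<in> range fin_cord")
    case True
    then obtain j where "\<gamma> = fin_cord j" by blast
    then show ?thesis
      using f_None[of j] by (simp add: image_iff domIff not_le)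
  next
    case False
    then show ?thesis
      by (auto simp: nat_word_def)
  qed
  then have "dom (nat_word f) = fin_cord ` {..<k}"
    by blast
  also have "\<dots> = {..<fin_cord k}"
  proof
    show "{..<fin_cord k} \<subseteq> fin_cord ` {..<k}"
    proof
      fix \<gamma>
      assume "\<gamma> \<in> {..<fin_cord k}"
      moreover from this obtain m where "\<gamma> = fin_cord m"
        using le_fin_cordD[of \<gamma> k] by (auto simp: less_imp_le)
      ultimately show "\<gamma> \<in> fin_cord ` {..<k}"
        by simp
    qed
  qed auto
  finally show ?thesis
    using True by (simp add: k_def)
next
  case False
  have "nat_word f \<gamma> \<noteq> None \<longleftrightarrow> \<gamma> < \<omega>" for \<gamma>
    using False unfolding nat_word_def less_omega_iff by simp
  then have "dom (nat_word f) = {..<\<omega>}"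
    by (simp add: dom_def lessThan_def)
  then show ?thesis
    unfolding if_not_P[OF False] .
qed

lemma is_word_nat_word: "down_closed f \<Longrightarrow> is_word (nat_word f)"
  by (simp add: is_word_def dom_nat_word)

lemma wlen_nat_word_le:
  assumes "down_closed f"
  shows "wlen (nat_word f) \<le> \<omega>"
proof -
  have "fin_cord k \<le> \<omega>" for k
    by (simp add: less_imp_le less_omega_iff)
  then show ?thesis
    using dom_nat_word[OF assms] by (auto dest!: wlen_eq split: if_splits)
qed

lemma wlen_nat_word_total:
  assumes "\<And>i. f i \<noteq> None"
  shows "wlen (nat_word f) = \<omega>"
proof (rule wlen_eq)
  have "down_closed f"
    by (simp add: down_closed_def assms)
  from dom_nat_word[OF this] show "dom (nat_word f) = {..<\<omega>}"
    using assms by simp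
qed

lemma nat_word_in_words:
  assumes "down_closed f" "ran f \<subseteq> Pow AP"
  shows "nat_word f \<in> words AP"
proof -
  have "ran (nat_word f) \<subseteq> ran f"
    by (auto simp: nat_word_def ran_def split: if_splits)
  then show ?thesis
    using is_word_nat_word[OF assms(1)] assms(2) by (auto simp: words_def is_word_def)
qed

section \<open>Word-expressions for eventually constant sequences\<close>

lemma denotation_single: "denotation (Letter \<sigma>) = nat_word [0 \<mapsto> \<sigma>]"
proof
  fix \<gamma>
  show "denotation (Letter \<sigma>) \<gamma> = nat_word [0 \<mapsto> \<sigma>] \<gamma>"
  proof (cases "\<gamma> \<in> range fin_cord")
    case True
    then obtain i where "\<gamma> = fin_cord i" by blast
    moreover have "fin_cord i = 0 \<longleftrightarrow> i = 0"
      by (metis fin_cord.simps(1) fin_cord_eq_iff)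
    ultimately show ?thesis by simp
  next
    case False
    then have "\<gamma> \<noteq> 0"
      by (metis fin_cord.simps(1) rangeI)
    with False show ?thesis
      by (simp add: nat_word_def)
  qed
qed

lemma denotation_constant: "denotation (Omega (Letter \<sigma>)) = nat_word (\<lambda>_. Some \<sigma>)"
  by (auto simp: word_omega_def nat_word_def less_omega_iff)

text \<open>Every nonzero position has the form \<open>1 + d\<close>, and at finite \<open>d\<close>
  the shift is the successor on \<open>nat\<close>.\<close>

lemma word_concat_singleton:
  "word_concat [0 \<mapsto> \<sigma>] (nat_word f) = nat_word (case_nat (Some \<sigma>) f)"
proof
  fix \<gamma> :: cord
  consider "\<gamma> = 0" | d where "\<gamma> = 1 + d"
    using cord_le_imp_plus[of 1 \<gamma>] by (metis cord_less_one_iff not_le)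
  then show "word_concat [0 \<mapsto> \<sigma>] (nat_word f) \<gamma> = nat_word (case_nat (Some \<sigma>) f) \<gamma>"
  proof cases
    case 1
    then show ?thesis
      using nat_word_fin[of "case_nat (Some \<sigma>) f" 0] by (simp add: word_concat_def)
  next
    case (2 d)
    have "\<not> \<gamma> < 1"
      by (simp add: 2 not_less del: cord_less_one_iff)
    then have "word_concat [0 \<mapsto> \<sigma>] (nat_word f) \<gamma> = nat_word f d"
      by (simp add: word_concat_def 2 del: cord_less_one_iff)
    also have "\<dots> = nat_word (case_nat (Some \<sigma>) f) \<gamma>"
    proof (cases "d \<in> range fin_cord")
      case True
      then obtain i where "d = fin_cord i" by blast
      then show ?thesis
        by (simp add: 2 one_plus_fin_cord del: fin_cord.simps)
    next
      case False
      \<comment> \<open>Both sides are \<open>None\<close> here: since \<open>d \<le> 1 + d\<close>,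
        a finite \<open>\<gamma>\<close> would make \<open>d\<close> finite.\<close>
      have "\<gamma> \<notin> range fin_cord"
      proof
        assume "\<gamma> \<in> range fin_cord"
        then obtain i where i: "\<gamma> = fin_cord i" by blast
        have "d \<le> fin_cord i"
          using cord_le_plus_left[of d 1] by (simp add: 2 flip: i)
        with False show False
          using le_fin_cordD by blast
      qed
      with False show ?thesis
        by (simp add: nat_word_def)
    qed
    finally show ?thesis .
  qed
qed

text \<open>Induction on \<open>n\<close>, peeling off first letters with \<open>Concat\<close>
  until the sequence is constant and an omega-power of one letter denotes it. The sequence must
  start with a letter because no expression denotes the empty word.\<close>

lemma finitely_presentable_nat_word:
  assumes "down_closed f" "f 0 \<noteq> None" "ran f \<subseteq> Pow AP" "\<And>i. i \<ge> n \<Longrightarrow> f i = f n"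
  shows "finitely_presentable AP (nat_word f)"
  using assms
proof (induction n arbitrary: f)
  case 0
  then obtain \<sigma> where \<sigma>: "f = (\<lambda>_. Some \<sigma>)"
    by (metis le0 option.exhaust)
  then have "letters (Omega (Letter \<sigma>)) \<subseteq> Pow AP"
    using 0(3) by (auto simp: ran_def)
  then show ?case
    unfolding finitely_presentable_def \<sigma> using denotation_constant by blast
next
  case (Suc n)
  obtain \<sigma> where \<sigma>: "f 0 = Some \<sigma>"
    using Suc.prems(2) by auto
  then have \<sigma>_AP: "\<sigma> \<in> Pow AP"
    using Suc.prems(3) by (auto simp: ran_def)
  show ?case
  \<comment> \<open>If nothing follows the first letter, the tail would be the empty word, outside
    the induction hypothesis; the letter alone is then the expression.\<close>
  proof (cases "f 1 = None")
    case True
    then have "f = [0 \<mapsto> \<sigma>]"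
      using down_closedD[OF Suc.prems(1) True] \<sigma> by (auto simp: fun_eq_iff)
    then have "denotation (Letter \<sigma>) = nat_word f"
      by (simp only: denotation_single)
    then show ?thesis
      unfolding finitely_presentable_def using \<sigma>_AP by (intro exI[of _ "Letter \<sigma>"]) simp
  next
    case False
    define g where "g = (\<lambda>i. f (Suc i))"
    have "finitely_presentable AP (nat_word g)"
    proof (rule Suc.IH)
      show "down_closed g"
        using Suc.prems(1) by (simp add: down_closed_def g_def)
      show "g 0 \<noteq> None"
        using False by (simp add: g_def)
      show "ran g \<subseteq> Pow AP"
        using Suc.prems(3) by (auto simp: g_def ran_def)
      show "g i = g n" if "n \<le> i" for i
        unfolding g_def using that Suc.prems(4)[of "Suc i"] by simp
    qed
    then obtain A where A: "letters A \<subseteq> Pow AP" "denotation A = nat_word g"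
      unfolding finitely_presentable_def by blast
    have "case_nat (Some \<sigma>) g = f"
      using \<sigma> by (auto simp: g_def fun_eq_iff split: nat.split)
    then have "denotation (Concat (Letter \<sigma>) A) = nat_word f"
      by (simp add: A(2) word_concat_singleton)
    then show ?thesis
      unfolding finitely_presentable_def using A(1) \<sigma>_AP
      by (intro exI[of _ "Concat (Letter \<sigma>) A"]) simp
  qed
qed


section \<open>Characterizing examples\<close>

text \<open>One construction for all bounds: \<open>c = None\<close> truncates,
  \<open>c = Some {}\<close> pads with the least letter, \<open>c = Some AP\<close> with the
  greatest.\<close>

definition padded_prefix :: "nat \<Rightarrow> 'p set option \<Rightarrow> 'p word \<Rightarrow> nat \<Rightarrow> 'p set option" where
  "padded_prefix n c w = (\<lambda>i. if i < n then w (fin_cord i) else c)"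

lemma finite_padded_prefixes:
  assumes "finite AP" "W \<subseteq> words AP"
  shows "finite (padded_prefix n c ` W)"
proof -
  define B where "B = insert None (Some ` Pow AP)"
  have B: "w \<gamma> \<in> B" if "w \<in> W" for w \<gamma>
  proof -
    have "ran w \<subseteq> Pow AP"
      using that assms(2) words_ran by blast
    then show ?thesis
      by (cases "w \<gamma>") (auto simp: B_def dest: ranI)
  qed
  have "padded_prefix n c ` W \<subseteq>
      {f. \<forall>i. (i \<in> {..<n} \<longrightarrow> f i \<in> B) \<and> (i \<notin> {..<n} \<longrightarrow> f i = c)}"
    using B by (simp add: padded_prefix_def image_subset_iff)
  moreover have "finite B"
    using assms(1) by (simp add: B_def)
  then have "finite {f. \<forall>i. (i \<in> {..<n} \<longrightarrow> f i \<in> B) \<and> (i \<notin> {..<n} \<longrightarrow> f i = c)}"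
    by (intro finite_set_of_finite_funs) simp_all
  ultimately show ?thesis
    by (rule finite_subset)
qed

lemma is_word_fin_None:
  assumes "is_word w" "w (fin_cord i) = None" "i \<le> j"
  shows "w (fin_cord j) = None"
proof -
  have "\<not> fin_cord i < wlen w"
    using assms(2) by (simp add: less_wlen_iff[OF assms(1)])
  moreover have "fin_cord i \<le> fin_cord j"
    by (simp only: fin_cord_le_iff assms(3))
  ultimately have "\<not> fin_cord j < wlen w"
    by order
  then show ?thesis
    by (simp add: less_wlen_iff[OF assms(1)])
qed

text \<open>Padding a word that has no letter at position \<open>d\<close>, the last one kept, would
  leave a gap before the padding; the second premise excludes this.\<close>

lemma down_closed_padded_prefix:
  assumes "is_word w" "c \<noteq> None \<Longrightarrow> w (fin_cord d) \<noteq> None"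
  shows "down_closed (padded_prefix (Suc d) c w)"
  unfolding down_closed_def
proof (intro allI impI)
  fix i
  assume i: "padded_prefix (Suc d) c w i = None"
  consider "i < d" | "i = d" | "d < i"
    by linarith
  then show "padded_prefix (Suc d) c w (Suc i) = None"
  proof cases
    case 1
    then show ?thesis
      using i is_word_fin_None[OF assms(1), of i "Suc i"]
      by (simp add: padded_prefix_def del: fin_cord.simps)
  next
    case 2
    then have "c = None"
      using i assms(2) by (cases c) (auto simp: padded_prefix_def)
    then show ?thesis
      using 2 by (simp add: padded_prefix_def)
  qed (use i in \<open>simp add: padded_prefix_def\<close>)
qed

lemma ran_padded_prefix:
  assumes "w \<in> words AP" "\<And>\<sigma>. c = Some \<sigma> \<Longrightarrow> \<sigma> \<subseteq> AP"
  shows "ran (padded_prefix n c w) \<subseteq> Pow AP"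
proof
  fix \<sigma>
  assume "\<sigma> \<in> ran (padded_prefix n c w)"
  then obtain i where "padded_prefix n c w i = Some \<sigma>"
    by (auto simp: ran_def)
  then have "\<sigma> \<in> ran w \<or> c = Some \<sigma>"
    by (auto simp: padded_prefix_def intro: ranI split: if_splits)
  then show "\<sigma> \<in> Pow AP"
    using assms(2) words_ran[OF assms(1)] by auto
qed

text \<open>The squeezing argument for an arbitrary class \<open>W\<close>. Agreement up to the
  depth of \<open>\<phi>\<close> makes \<open>\<phi>\<close> itself fit, while the bounds hold at
  all finite positions and therefore transfer any \<open>\<psi>\<close> from \<open>lo w\<close> to
  \<open>w\<close> and from \<open>w\<close> to \<open>hi w\<close>, whatever its depth.\<close>

lemma characterizing_examples:
  assumes "finite (lo ` W)" "finite (hi ` W)"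
    and word: "\<And>w. w \<in> W \<Longrightarrow> is_word w \<and> is_word (lo w) \<and> is_word (hi w)"
    and agree: "\<And>w i. w \<in> W \<Longrightarrow> i \<le> depth \<phi> \<Longrightarrow>
      lo w (fin_cord i) = w (fin_cord i) \<and> hi w (fin_cord i) = w (fin_cord i)"
    and bounds: "\<And>w i. w \<in> W \<Longrightarrow> letter_le (lo w (fin_cord i)) (w (fin_cord i)) \<and>
      letter_le (w (fin_cord i)) (hi w (fin_cord i))"
  shows "\<exists>E. finite E \<and> fst ` E \<subseteq> lo ` W \<union> hi ` W \<and> fits \<phi> E \<and>
    (\<forall>\<psi>. fits \<psi> E \<longrightarrow> (\<forall>w\<in>W. w \<Turnstile> \<psi> \<longleftrightarrow> w \<Turnstile> \<phi>))"
proof -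
  define E where "E = (\<lambda>w. (lo w, Pos)) ` {w \<in> W. w \<Turnstile> \<phi>} \<union> (\<lambda>w. (hi w, Neg)) ` {w \<in> W. \<not> w \<Turnstile> \<phi>}"
  \<comment> \<open>\<open>W\<close> may be infinite; finiteness comes from the images under
    \<open>lo\<close> and \<open>hi\<close>.\<close>
  have "E \<subseteq> lo ` W \<times> {Pos} \<union> hi ` W \<times> {Neg}"
    by (auto simp: E_def)
  moreover have "finite (lo ` W \<times> {Pos} \<union> hi ` W \<times> {Neg})"
    using assms(1,2) by simp
  ultimately have "finite E" "fst ` E \<subseteq> lo ` W \<union> hi ` W"
    by (auto intro: finite_subset)
  moreover have "lo w \<Turnstile> \<phi> \<longleftrightarrow> w \<Turnstile> \<phi>" "hi w \<Turnstile> \<phi> \<longleftrightarrow> w \<Turnstile> \<phi>" if "w \<in> W" for w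
    using word[OF that] agree[OF that] sat_cong[of "lo w" w \<phi>] sat_cong[of "hi w" w \<phi>] by simp_all
  then have "fits \<phi> E"
    by (auto simp: fits_def E_def)
  moreover have "w \<Turnstile> \<psi> \<longleftrightarrow> w \<Turnstile> \<phi>" if "fits \<psi> E" "w \<in> W" for \<psi> w
  proof
    show "w \<Turnstile> \<psi>" if "w \<Turnstile> \<phi>"
    proof (rule sat_mono)
      show "lo w \<Turnstile> \<psi>"
        using \<open>fits \<psi> E\<close> \<open>w \<in> W\<close> that by (auto simp: fits_def E_def)
    qed (use word[OF \<open>w \<in> W\<close>] bounds[OF \<open>w \<in> W\<close>] in auto)
  next
    \<comment> \<open>If \<open>w\<close> failed \<open>\<phi>\<close>, then \<open>hi w\<close>
      would be a negative example, yet it satisfies \<open>\<psi>\<close>.\<close>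
    assume "w \<Turnstile> \<psi>"
    then have "hi w \<Turnstile> \<psi>"
      using word[OF \<open>w \<in> W\<close>] bounds[OF \<open>w \<in> W\<close>] by (intro sat_mono[of w "hi w"]) auto
    then show "w \<Turnstile> \<phi>"
      using \<open>fits \<psi> E\<close> \<open>w \<in> W\<close> by (fastforce simp: fits_def E_def)
  qed
  ultimately show ?thesis by blast
qed

section \<open>Bounds for the two classes of words\<close>

lemma word_letter_le_AP: "w \<in> words AP \<Longrightarrow> letter_le (w \<gamma>) (Some AP)"
  using words_ran[of w AP] by (auto simp: letter_le_def dest: ranI)

text \<open>Examples must have length exactly \<omega>, so the lower bound cannot truncate; it pads
  with \<open>{}\<close>, the least letter such a word can carry.\<close>

lemma characterization_omega:
  fixes AP :: "'p set"
  assumes "finite AP"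
  obtains E where "finite E" "fst ` E \<subseteq> words_omega AP" "fits \<phi> E"
    "\<And>\<psi> w. fits \<psi> E \<Longrightarrow> w \<in> words_omega AP \<Longrightarrow> w \<Turnstile> \<psi> \<longleftrightarrow> w \<Turnstile> \<phi>"
proof -
  \<comment> \<open>\<open>\<phi>\<close> reads positions 0 up to its depth inclusive.\<close>
  let ?n = "Suc (depth \<phi>)"
  define pad where "pad \<sigma> w = nat_word (padded_prefix ?n (Some \<sigma>) w)" for \<sigma> and w :: "'p word"
  have W: "w \<in> words AP" "is_word w" "w (fin_cord i) \<noteq> None" if "w \<in> words_omega AP" for w i
  proof -
    show "w \<in> words AP"
      using that by (simp add: words_omega_def)
    then show "is_word w"
      by (rule words_is_word)
    from less_wlen_iff[OF this, of "fin_cord i"] show "w (fin_cord i) \<noteq> None"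
      using that by (simp add: words_omega_def less_omega_iff)
  qed
  have pad_omega: "pad \<sigma> w \<in> words_omega AP" if "w \<in> words_omega AP" "\<sigma> \<subseteq> AP" for \<sigma> w
  proof -
    have "pad \<sigma> w \<in> words AP"
      unfolding pad_def using W[OF that(1)] that(2)
      by (intro nat_word_in_words down_closed_padded_prefix ran_padded_prefix) auto
    moreover have "wlen (pad \<sigma> w) = \<omega>"
      unfolding pad_def using W(3)[OF that(1)] by (intro wlen_nat_word_total) (simp add: padded_prefix_def)
    ultimately show ?thesis
      by (simp add: words_omega_def)
  qed
  have fin: "finite (pad \<sigma> ` words_omega AP)" for \<sigma>
  proof -
    have "finite (padded_prefix ?n (Some \<sigma>) ` words_omega AP)"
      using assms W(1) by (intro finite_padded_prefixes) auto
    then have "finite (nat_word ` padded_prefix ?n (Some \<sigma>) ` words_omega AP)"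
      by (rule finite_imageI)
    then show ?thesis
      by (simp add: pad_def image_image)
  qed
  have "\<exists>E. finite E \<and> fst ` E \<subseteq> pad {} ` words_omega AP \<union> pad AP ` words_omega AP \<and> fits \<phi> E \<and>
    (\<forall>\<psi>. fits \<psi> E \<longrightarrow> (\<forall>w\<in>words_omega AP. w \<Turnstile> \<psi> \<longleftrightarrow> w \<Turnstile> \<phi>))"
  proof (rule characterizing_examples)
    fix w i
    assume w: "w \<in> words_omega AP"
    then show "is_word w \<and> is_word (pad {} w) \<and> is_word (pad AP w)"
      using pad_omega W(2) by blast
    show "letter_le (pad {} w (fin_cord i)) (w (fin_cord i)) \<and>
      letter_le (w (fin_cord i)) (pad AP w (fin_cord i))"
      using W(3)[OF w, of i] word_letter_le_AP[OF W(1)[OF w]]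
      by (auto simp: pad_def padded_prefix_def) (auto simp: letter_le_def)
  next
    fix w i
    assume "w \<in> words_omega AP" "i \<le> depth \<phi>"
    then show "pad {} w (fin_cord i) = w (fin_cord i) \<and> pad AP w (fin_cord i) = w (fin_cord i)"
      by (simp add: pad_def padded_prefix_def)
  qed (rule fin)+
  then obtain E where E: "finite E" "fst ` E \<subseteq> pad {} ` words_omega AP \<union> pad AP ` words_omega AP"
    "fits \<phi> E" "\<And>\<psi> w. fits \<psi> E \<Longrightarrow> w \<in> words_omega AP \<Longrightarrow> w \<Turnstile> \<psi> \<longleftrightarrow> w \<Turnstile> \<phi>"
    by blast
  have E_omega: "fst ` E \<subseteq> words_omega AP"
  proof -
    have "pad \<sigma> ` words_omega AP \<subseteq> words_omega AP" if "\<sigma> \<subseteq> AP" for \<sigma>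
      using that by (intro image_subsetI pad_omega)
    from this[of "{}"] this[of AP] have
      "pad {} ` words_omega AP \<union> pad AP ` words_omega AP \<subseteq> words_omega AP"
      by simp
    with E(2) show ?thesis
      by (rule subset_trans)
  qed
  show ?thesis
    using E(1) E_omega E(3,4) by (rule that)
qed

text \<open>Words of every countable length are compared, but the bounds only concern finite
  positions, so examples of length at most \<omega> suffice. Being eventually constant or finite,
  they are presentable.\<close>

lemma characterization_presentable:
  fixes AP :: "'p set"
  assumes "finite AP"
  obtains E where "finite E"
    "\<And>w. w \<in> fst ` E \<Longrightarrow> w \<in> words AP \<and> finitely_presentable AP w \<and> wlen w \<le> \<omega>"
    "fits \<phi> E" "\<And>\<psi> w. fits \<psi> E \<Longrightarrow> w \<in> words AP \<Longrightarrow> w \<Turnstile> \<psi> \<longleftrightarrow> w \<Turnstile> \<phi>"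
proof -
  let ?d = "depth \<phi>"
  \<comment> \<open>The bounds of the empty word would be empty and hence not presentable; it is
    treated separately at the end.\<close>
  define W where "W = {w \<in> words AP. w \<noteq> Map.empty}"
  \<comment> \<open>A word without a letter at position \<open>?d\<close> has already ended, so
    nothing may be appended and it is its own upper bound.\<close>
  define top where "top w = (if w (fin_cord ?d) = None then None else Some AP)" for w :: "'p word"
  define lo where "lo w = nat_word (padded_prefix (Suc ?d) None w)" for w :: "'p word"
  define hi where "hi w = nat_word (padded_prefix (Suc ?d) (top w) w)" for w :: "'p word"
  have W: "w \<in> words AP" "is_word w" "w (fin_cord 0) \<noteq> None" if "w \<in> W" for w
  proof -
    show w: "w \<in> words AP"
      using that by (simp add: W_def)
    then show "is_word w"
      by (rule words_is_word)
    have "\<exists>\<gamma>. w \<gamma> \<noteq> None"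
      using that by (auto simp: W_def fun_eq_iff)
    then show "w (fin_cord 0) \<noteq> None"
      using less_wlen_iff[OF \<open>is_word w\<close>] by (metis cord_zero_le fin_cord.simps(1) le_less_trans)
  qed
  have example: "is_word v \<and> v \<in> words AP \<and> finitely_presentable AP v \<and> wlen v \<le> \<omega>"
    if "w \<in> W" "c = None \<or> c = top w" "v = nat_word (padded_prefix (Suc ?d) c w)" for v w c
  proof -
    have dc: "down_closed (padded_prefix (Suc ?d) c w)"
      using that(2) W(2)[OF that(1)]
      by (intro down_closed_padded_prefix) (auto simp: top_def split: if_splits)
    moreover have ran: "ran (padded_prefix (Suc ?d) c w) \<subseteq> Pow AP"
      using that(2) W(1)[OF that(1)] by (intro ran_padded_prefix) (auto simp: top_def split: if_splits)
    moreover have "finitely_presentable AP v"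
      unfolding that(3) using W(3)[OF that(1)]
      by (intro finitely_presentable_nat_word[OF dc _ ran, of "Suc ?d"]) (auto simp: padded_prefix_def)
    ultimately show ?thesis
      by (simp add: that(3) is_word_nat_word nat_word_in_words wlen_nat_word_le)
  qed
  have exlo: "is_word (lo w) \<and> lo w \<in> words AP \<and> finitely_presentable AP (lo w) \<and> wlen (lo w) \<le> \<omega>"
    if "w \<in> W" for w
    using that lo_def by (intro example) auto
  have exhi: "is_word (hi w) \<and> hi w \<in> words AP \<and> finitely_presentable AP (hi w) \<and> wlen (hi w) \<le> \<omega>"
    if "w \<in> W" for w
    using that hi_def by (intro example) auto
  have fin: "finite (nat_word ` padded_prefix (Suc ?d) c ` W)" for c
    using assms W(1) by (intro finite_imageI finite_padded_prefixes) auto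
  have "\<exists>E. finite E \<and> fst ` E \<subseteq> lo ` W \<union> hi ` W \<and> fits \<phi> E \<and>
    (\<forall>\<psi>. fits \<psi> E \<longrightarrow> (\<forall>w\<in>W. w \<Turnstile> \<psi> \<longleftrightarrow> w \<Turnstile> \<phi>))"
  proof (rule characterizing_examples)
    show "finite (lo ` W)"
      using fin[of None] by (simp add: lo_def image_image)
    \<comment> \<open>The padding depends on \<open>w\<close>, but only two values occur, each
      giving finitely many words.\<close>
    have "hi ` W \<subseteq> nat_word ` padded_prefix (Suc ?d) None ` W \<union>
        nat_word ` padded_prefix (Suc ?d) (Some AP) ` W"
      by (auto simp: hi_def top_def)
    then show "finite (hi ` W)"
      by (rule finite_subset) (intro finite_UnI fin)
  next
    fix w i
    assume w: "w \<in> W"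
    show "is_word w \<and> is_word (lo w) \<and> is_word (hi w)"
      using w by (simp add: W(2) exlo exhi)
    have "letter_le (w (fin_cord i)) (top w)" if "\<not> i < Suc ?d"
      using that is_word_fin_None[OF W(2)[OF w], of ?d i] word_letter_le_AP[OF W(1)[OF w]]
      by (auto simp: top_def)
    then show "letter_le (lo w (fin_cord i)) (w (fin_cord i)) \<and>
      letter_le (w (fin_cord i)) (hi w (fin_cord i))"
      by (simp add: lo_def hi_def padded_prefix_def)
  next
    fix w i
    assume "w \<in> W" "i \<le> ?d"
    then show "lo w (fin_cord i) = w (fin_cord i) \<and> hi w (fin_cord i) = w (fin_cord i)"
      by (simp add: lo_def hi_def padded_prefix_def)
  qed
  then obtain E where E: "finite E" "fst ` E \<subseteq> lo ` W \<union> hi ` W" "fits \<phi> E"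
    "\<And>\<psi> w. fits \<psi> E \<Longrightarrow> w \<in> W \<Longrightarrow> w \<Turnstile> \<psi> \<longleftrightarrow> w \<Turnstile> \<phi>"
    by blast
  have agree: "w \<Turnstile> \<psi> \<longleftrightarrow> w \<Turnstile> \<phi>" if "fits \<psi> E" "w \<in> words AP" for \<psi> w
  proof (cases "w = Map.empty")
    case True
    \<comment> \<open>The empty word satisfies the same formulas as this one-letter word, so
      agreement carries over.\<close>
    have "[0 \<mapsto> {}] \<in> W"
      using dom_singleton[of "{}"] by (auto simp: W_def words_def)
    from E(4)[OF that(1) this] show ?thesis
      by (simp add: True sat_empty_word)
  next
    case False
    with that show ?thesis
      by (intro E(4)) (auto simp: W_def)
  qed
  have ex: "w \<in> words AP \<and> finitely_presentable AP w \<and> wlen w \<le> \<omega>" if "w \<in> fst ` E" for w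
  proof -
    from E(2) that have "w \<in> lo ` W \<union> hi ` W"
      by (rule subsetD)
    with exlo exhi show ?thesis
      by auto
  qed
  show ?thesis
    using E(1) ex E(3) agree by (rule that)
qed

theorem theorem14:
  fixes AP :: "'p set"
  assumes "finite AP"
  shows "admits_finite_characterizations AP (ltl_formulas AP) (words_le_omega AP) \<and>
    admits_finite_characterizations AP (ltl_formulas AP) (words_omega AP) \<and>
    (\<forall>\<phi>\<in>ltl_formulas AP. \<exists>E.
       uniquely_characterizes AP E \<phi> (ltl_formulas AP) \<and>
       (\<forall>(w, l)\<in>E. finitely_presentable AP w \<and> wlen w \<le> \<omega>))"
proof -
  have sem_eq: "sem AP \<psi> \<inter> W = sem AP \<phi> \<inter> W"
    if "\<And>w. w \<in> W \<Longrightarrow> w \<Turnstile> \<psi> \<longleftrightarrow> w \<Turnstile> \<phi>" for W and \<phi> \<psi> :: "'p ltl"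
    using that by (auto simp: sem_def)
  \<comment> \<open>This class needs examples of its own, since those characterizing
    \<open>\<phi>\<close> over all words may be finite words.\<close>
  have "\<exists>E. finite E \<and> fst ` E \<subseteq> words_omega AP \<and> fits \<phi> E \<and>
    (\<forall>\<psi>\<in>L. fits \<psi> E \<longrightarrow> sem AP \<psi> \<inter> words_omega AP = sem AP \<phi> \<inter> words_omega AP)" for \<phi> L
  proof -
    obtain E where E: "finite E" "fst ` E \<subseteq> words_omega AP" "fits \<phi> E"
      "\<And>\<psi> w. fits \<psi> E \<Longrightarrow> w \<in> words_omega AP \<Longrightarrow> w \<Turnstile> \<psi> \<longleftrightarrow> w \<Turnstile> \<phi>"
      by (rule characterization_omega[OF assms, of \<phi>]) (rule that)
    show ?thesis
      by (intro exI[of _ E] conjI ballI impI sem_eq E)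
  qed
  then have omega: "admits_finite_characterizations AP (ltl_formulas AP) (words_omega AP)"
    unfolding admits_finite_characterizations_def by (intro ballI)
  have char: "\<exists>E. uniquely_characterizes AP E \<phi> (ltl_formulas AP) \<and>
    (\<forall>(w, l)\<in>E. finitely_presentable AP w \<and> wlen w \<le> \<omega>)" for \<phi>
  proof -
    obtain E where E: "finite E"
      "\<And>w. w \<in> fst ` E \<Longrightarrow> w \<in> words AP \<and> finitely_presentable AP w \<and> wlen w \<le> \<omega>"
      "fits \<phi> E" "\<And>\<psi> w. fits \<psi> E \<Longrightarrow> w \<in> words AP \<Longrightarrow> w \<Turnstile> \<psi> \<longleftrightarrow> w \<Turnstile> \<phi>"
      by (rule characterization_presentable[OF assms, of \<phi>]) (rule that)
    have same_sem: "sem AP \<psi> = sem AP \<phi>" if "fits \<psi> E" for \<psi>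
      unfolding sem_def by (intro Collect_cong conj_cong refl E(4)[OF that])
    have "fst ` E \<subseteq> words AP"
      using E(2) by (intro subsetI) simp
    then have "uniquely_characterizes AP E \<phi> (ltl_formulas AP)"
      unfolding uniquely_characterizes_def by (intro conjI ballI impI E(1,3) same_sem)
    moreover have "\<forall>(w, l)\<in>E. finitely_presentable AP w \<and> wlen w \<le> \<omega>"
      by (intro ballI) (simp add: split_beta E(2)[OF imageI])
    ultimately show ?thesis
      by (intro exI[of _ E] conjI)
  qed
  \<comment> \<open>The examples for all words already have length at most \<omega>, and equality of
    the full semantics restricts to any class.\<close>
  have "\<exists>E. finite E \<and> fst ` E \<subseteq> words_le_omega AP \<and> fits \<phi> E \<and>
    (\<forall>\<psi>\<in>ltl_formulas AP. fits \<psi> E \<longrightarrow>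
      sem AP \<psi> \<inter> words_le_omega AP = sem AP \<phi> \<inter> words_le_omega AP)" for \<phi>
  proof -
    obtain E where E: "uniquely_characterizes AP E \<phi> (ltl_formulas AP)"
      "\<forall>(w, l)\<in>E. finitely_presentable AP w \<and> wlen w \<le> \<omega>"
      using char[of \<phi>] by blast
    then have "fst ` E \<subseteq> words AP"
      unfolding uniquely_characterizes_def by (elim conjE)
    then have "fst ` E \<subseteq> words_le_omega AP"
      using E(2) by (simp add: image_subset_iff words_le_omega_def split_beta)
    moreover have "sem AP \<psi> \<inter> W = sem AP \<phi> \<inter> W"
      if "\<psi> \<in> ltl_formulas AP" "fits \<psi> E" for \<psi> W
    proof -
      from E(1) that have "sem AP \<psi> = sem AP \<phi>"
        unfolding uniquely_characterizes_def by blast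
      then show ?thesis
        by (rule arg_cong)
    qed
    moreover from E(1) have "finite E" "fits \<phi> E"
      unfolding uniquely_characterizes_def by blast+
    ultimately show ?thesis
      by (intro exI[of _ E] conjI ballI impI)
  qed
  then have "admits_finite_characterizations AP (ltl_formulas AP) (words_le_omega AP)"
    unfolding admits_finite_characterizations_def by (intro ballI)
  then show ?thesis
    using omega char by (intro conjI ballI)
qed

end
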